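(* Every Horton set with at least $26$ points, each point colored arbitrarily with one of $4$ colors, contains a monochromatic triangle (three points of the set of the same color) with at most $1$ point of the set in its interior.
   Context: A Horton set is a finite set $H=\{h_1,\dots,h_n\}$ of points in the plane, no three on a line, with distinct $x$-coordinates and sorted so that $h_1<_x h_2<_x\cdots<_x h_n$ (ordered by $x$-coordinate), defined recursively: a set with at most one point is a Horton set, and for $n\ge 2$, $H$ is a Horton set if the set $H^+=\{h_2,h_4,\dots\}$ of even-indexed points and the set $H^-=\{h_1,h_3,\dots\}$ of odd-indexed points are both Horton sets, every line through two points of $H^+$ leaves all points of $H^-$ strictly below it, and every line through two points of $H^-$ leaves all points of $H^+$ strictly above it. *)

theory Defs
  imports "HOL-Analysis.Analysis"
begin

definition general_position :: "(real \<times> real) set \<Rightarrow> bool" where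
  "general_position S \<longleftrightarrow>
     (\<forall>a\<in>S. \<forall>b\<in>S. \<forall>c\<in>S. a \<noteq> b \<and> a \<noteq> c \<and> b \<noteq> c \<longrightarrow> \<not> collinear {a, b, c})"

text \<open>These are meant for non-vertical lines, where the point of the line on the same vertical
  as the given point is unique.\<close>

definition strictly_below_line :: "real \<times> real \<Rightarrow> (real \<times> real) set \<Rightarrow> bool" where
  "strictly_below_line r L \<longleftrightarrow> (\<exists>y. (fst r, y) \<in> L \<and> snd r < y)"

definition strictly_above_line :: "real \<times> real \<Rightarrow> (real \<times> real) set \<Rightarrow> bool" where
  "strictly_above_line r L \<longleftrightarrow> (\<exists>y. (fst r, y) \<in> L \<and> y < snd r)"

definition lines_above :: "(real \<times> real) set \<Rightarrow> (real \<times> real) set \<Rightarrow> bool" where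
  "lines_above A B \<longleftrightarrow>
     (\<forall>p\<in>A. \<forall>q\<in>A. p \<noteq> q \<longrightarrow> (\<forall>r\<in>B. strictly_below_line r (affine hull {p, q})))"

definition lines_below :: "(real \<times> real) set \<Rightarrow> (real \<times> real) set \<Rightarrow> bool" where
  "lines_below A B \<longleftrightarrow>
     (\<forall>p\<in>A. \<forall>q\<in>A. p \<noteq> q \<longrightarrow> (\<forall>r\<in>B. strictly_above_line r (affine hull {p, q})))"

text \<open>In the second rule \<open>h 1, \<dots>, h n\<close> lists the points of the set by increasing x-coordinate;
  indices start at 1, so the leftmost point lies in the odd-indexed half.\<close>

inductive horton_set :: "(real \<times> real) set \<Rightarrow> bool" where
  small: "horton_set H" if "finite H" "card H \<le> 1"
| split: "horton_set H"
    if "(n::nat) \<ge> 2"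
      and "H = h ` {1..n}"
      and "strict_mono_on {1..n} (\<lambda>i. fst (h i))"
      and "general_position H"
      and "Hplus = h ` {i \<in> {1..n}. even i}"
      and "Hminus = h ` {i \<in> {1..n}. odd i}"
      and "horton_set Hplus"
      and "horton_set Hminus"
      and "lines_above Hplus Hminus"
      and "lines_below Hminus Hplus"

end

theory Submission
  imports Defs "HOL-Library.Code_Binary_Nat"
begin

text \<open>The order type of a Horton set is determined by its size: number the points from \<open>0\<close> by
  increasing x-coordinate; the orientation of three points is then read off the lowest binary digit
  at which their numbers do not all agree. Hence the question which points lie inside a triangle
  concerns natural numbers only. Among \<open>26\<close> points some colour occurs \<open>7\<close> times, and an exhaustive
  search shows that any \<open>7\<close> numbers below \<open>26\<close> contain three whose triangle has at most one
  interior point. Points inside a triangle lie between its vertices in x-order, so further points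
  to the right of the first \<open>26\<close> do not matter.\<close>

section \<open>Orientation of three points\<close>

text \<open>Twice the signed area of the triangle \<open>p q r\<close>, positive when it runs
  counterclockwise.\<close>

definition turn :: "real \<times> real \<Rightarrow> real \<times> real \<Rightarrow> real \<times> real \<Rightarrow> real" where
  "turn p q r = (fst q - fst p) * (snd r - snd p) - (snd q - snd p) * (fst r - fst p)"

lemma turn_rotate: "turn q r p = turn p q r"
  by (simp add: turn_def algebra_simps)

lemma turn_swap: "turn p r q = - turn p q r"
  by (simp add: turn_def algebra_simps)

text \<open>\<open>turn p q\<close> is affine in its last argument and vanishes on the line through
  \<open>p\<close> and \<open>q\<close>, so only the vertical offset from that line counts. Its sign
  tells above from below once \<open>fst p < fst q\<close>.\<close>

lemma turn_affine_hull:
  assumes "(fst r, y) \<in> affine hull {p, q}"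
  shows "turn p q r = (fst q - fst p) * (snd r - y)"
proof -
  obtain u v where uv: "u + v = 1" "fst r = u * fst p + v * fst q" "y = u * snd p + v * snd q"
    using assms by (auto simp: affine_hull_2 prod_eq_iff)
  have u: "u = 1 - v" using uv(1) by simp
  show ?thesis
    unfolding turn_def uv u by (simp add: algebra_simps)
qed

lemma turn_neg_if_below:
  assumes "strictly_below_line r (affine hull {p, q})" "fst p < fst q"
  shows "turn p q r < 0"
  using assms by (auto simp: strictly_below_line_def turn_affine_hull mult_less_0_iff)

lemma turn_pos_if_above:
  assumes "strictly_above_line r (affine hull {p, q})" "fst p < fst q"
  shows "turn p q r > 0"
  using assms by (auto simp: strictly_above_line_def turn_affine_hull zero_less_mult_iff)

text \<open>Barycentric coordinates are ratios of signed areas.\<close>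

lemma turn_convex_combination:
  assumes "x + y + z = 1"
  shows "turn a b (x *\<^sub>R a + y *\<^sub>R b + z *\<^sub>R c) = z * turn a b c"
proof -
  have x: "x = 1 - y - z" using assms by simp
  show ?thesis unfolding x by (simp add: turn_def algebra_simps)
qed

lemma not_collinear_if_turn:
  assumes "turn a b c \<noteq> 0"
  shows "\<not> collinear {a, b, c}"
proof
  assume "collinear {a, b, c}"
  then obtain u s t where "b - a = s *\<^sub>R u" "c - a = t *\<^sub>R u"
    unfolding collinear_def by (metis insertCI)
  then have "fst b - fst a = s * fst u" "snd b - snd a = s * snd u"
    "fst c - fst a = t * fst u" "snd c - snd a = t * snd u"
    by (simp_all add: prod_eq_iff)
  then show False using assms by (simp add: turn_def)
qed

text \<open>Interior points have positive barycentric coordinates, and replacing a vertex by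
  \<open>p\<close> multiplies the signed area by the coordinate of that vertex.\<close>

lemma interior_triangleE:
  assumes "p \<in> interior (convex hull {a, b, c})" "turn a b c \<noteq> 0" "fst a < fst b" "fst b < fst c"
  obtains "fst a < fst p" "fst p < fst c" "p \<noteq> b"
    "sgn (turn a b p) = sgn (turn a b c)" "sgn (turn b c p) = sgn (turn a b c)"
    "sgn (turn a p c) = sgn (turn a b c)"
proof -
  obtain x y z where xyz: "0 < x" "0 < y" "0 < z" "x + y + z = 1"
    and p: "p = x *\<^sub>R a + y *\<^sub>R b + z *\<^sub>R c"
    using assms(1) interior_convex_hull_3_minimal[OF not_collinear_if_turn[OF assms(2)]]
    by auto
  have x: "x = 1 - y - z" using xyz by simp
  have 1: "turn a b p = z * turn a b c"
    by (simp add: p turn_convex_combination xyz)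
  have 2: "turn b c p = x * turn a b c"
    using turn_convex_combination[of y z x b c a] xyz
    by (simp add: p ac_simps turn_rotate)
  have 3: "turn a p c = y * turn a b c"
    unfolding p x by (simp add: turn_def algebra_simps)
  have "fst p - fst a = y * (fst b - fst a) + z * (fst c - fst a)"
    unfolding p x by (simp add: algebra_simps)
  moreover have "y * (fst b - fst a) + z * (fst c - fst a) > 0"
    using assms xyz by (intro add_pos_pos mult_pos_pos) auto
  ultimately have a: "fst a < fst p" by simp
  have x': "z = 1 - x - y" using xyz by simp
  have "fst c - fst p = x * (fst c - fst a) + y * (fst c - fst b)"
    unfolding p x' by (simp add: algebra_simps)
  moreover have "x * (fst c - fst a) + y * (fst c - fst b) > 0"
    using assms xyz by (intro add_pos_pos mult_pos_pos) auto
  ultimately have c: "fst p < fst c" by simp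
  \<comment> \<open>\<open>turn a b b\<close> vanishes, whereas \<open>turn a b p\<close> does
    not.\<close>
  have "p \<noteq> b"
    using 1 xyz assms(2) by (auto simp: turn_def)
  then show thesis
    using a c 1 2 3 xyz by (intro that) (simp_all add: sgn_mult)
qed

section \<open>Ranks by x-coordinate and orientations in a Horton set\<close>

definition x_rank :: "(real \<times> real) set \<Rightarrow> real \<times> real \<Rightarrow> nat" where
  "x_rank S p = card {q \<in> S. fst q < fst p}"

lemma x_rank_image:
  fixes h :: "nat \<Rightarrow> real \<times> real"
  assumes "strict_mono_on A (\<lambda>i. fst (h i))" "i \<in> A"
  shows "x_rank (h ` A) (h i) = card {j \<in> A. j < i}"
proof -
  have "{q \<in> h ` A. fst q < fst (h i)} = h ` {j \<in> A. j < i}"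
    using assms(2) strict_mono_on_less[OF assms(1)] by (auto simp del: split_paired_All)
  moreover have "inj_on h {j \<in> A. j < i}"
    using strict_mono_on_imp_inj_on[OF assms(1)] by (auto simp: inj_on_def)
  ultimately show ?thesis
    by (simp add: x_rank_def card_image)
qed

lemma card_odd_less: "card {j. odd j \<and> j < m} = m div 2"
proof (induction m)
  case (Suc m)
  have "{j. odd j \<and> j < Suc m} = (if odd m then insert m else id) {j. odd j \<and> j < m}"
    by (auto simp: less_Suc_eq)
  then show ?case using Suc by auto
qed simp

lemma card_even_less: "card {j. even j \<and> 0 < j \<and> j < Suc m} = m div 2"
proof (induction m)
  case (Suc m)
  have "{j. even j \<and> 0 < j \<and> j < Suc (Suc m)} =
      (if odd m then insert (Suc m) else id) {j. even j \<and> 0 < j \<and> j < Suc m}"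
    by (auto simp: less_Suc_eq)
  then show ?case using Suc by auto
qed auto

text \<open>For ranks \<open>i < j < k\<close>: the point of rank \<open>j\<close> lies below the segment joining the other two.
  Ranks start at \<open>0\<close>, so the upper half consists of the odd ranks;
  the case \<open>k = 0\<close> only secures termination.\<close>

fun below_chord :: "nat \<Rightarrow> nat \<Rightarrow> nat \<Rightarrow> bool" where
  "below_chord i j k =
    (if k = 0 then False
     else if even i = even j \<and> even j = even k then below_chord (i div 2) (j div 2) (k div 2)
     else if even i = even k then odd i
     else even j)"

declare below_chord.simps [simp del]

text \<open>Induction along the halving. Three points of one half inherit their orientation from
  that half. Otherwise exactly two share a half, and the side of their line on which the third lies
  fixes the sign.\<close>

lemma horton_turn:
  assumes "horton_set H" "a \<in> H" "b \<in> H" "c \<in> H" "fst a < fst b" "fst b < fst c"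
  shows "turn a b c \<noteq> 0 \<and> (turn a b c > 0 \<longleftrightarrow> below_chord (x_rank H a) (x_rank H b) (x_rank H c))"
  using assms
proof (induction arbitrary: a b c rule: horton_set.induct)
  case (small H)
  then have "a = b"
    using card_le_Suc0_iff_eq[OF small.hyps(1)] by simp
  with small show ?case by simp
next
  case (split n H h Hplus Hminus)
  note mono = split.hyps(3)
  obtain i j k where ijk: "i \<in> {1..n}" "j \<in> {1..n}" "k \<in> {1..n}"
    and abc: "a = h i" "b = h j" "c = h k"
    using split.prems(1-3) unfolding split.hyps(2) by auto
  have "i < j" "j < k"
    using split.prems(4,5) ijk strict_mono_on_less[OF mono] by (simp_all add: abc)
  have x_rank: "x_rank H (h m) = m - 1" if "m \<in> {1..n}" for m
  proof -
    have "{l \<in> {1..n}. l < m} = {1..<m}" using that by auto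
    then show ?thesis
      using x_rank_image[OF mono that] by (simp add: split.hyps(2))
  qed
  \<comment> \<open>Passing to either half drops the lowest binary digit of the rank
    \<open>m - 1\<close>.\<close>
  have plus: "h m \<in> Hplus" "x_rank Hplus (h m) = (m - 1) div 2" if "m \<in> {1..n}" "even m" for m
  proof -
    show "h m \<in> Hplus" using that by (simp add: split.hyps(5))
    have sub: "strict_mono_on {i \<in> {1..n}. even i} (\<lambda>i. fst (h i))"
      by (rule monotone_on_subset[OF mono]) auto
    have mem: "m \<in> {i \<in> {1..n}. even i}" using that by simp
    have set: "{l \<in> {i \<in> {1..n}. even i}. l < m} = {l. even l \<and> 0 < l \<and> l < Suc (m - 1)}"
      using that by auto
    show "x_rank Hplus (h m) = (m - 1) div 2"
      unfolding split.hyps(5) x_rank_image[OF sub mem] set card_even_less by (rule refl)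
  qed
  have minus: "h m \<in> Hminus" "x_rank Hminus (h m) = (m - 1) div 2" if "m \<in> {1..n}" "odd m" for m
  proof -
    show "h m \<in> Hminus" using that by (simp add: split.hyps(6))
    have sub: "strict_mono_on {i \<in> {1..n}. odd i} (\<lambda>i. fst (h i))"
      by (rule monotone_on_subset[OF mono]) auto
    have mem: "m \<in> {i \<in> {1..n}. odd i}" using that by simp
    have set: "{l \<in> {i \<in> {1..n}. odd i}. l < m} = {l. odd l \<and> l < m}"
      using that by (auto simp: odd_pos Suc_le_eq)
    have div: "m div 2 = (m - 1) div 2"
      using that by (auto elim!: oddE)
    show "x_rank Hminus (h m) = (m - 1) div 2"
      unfolding split.hyps(6) x_rank_image[OF sub mem] set card_odd_less by (rule div)
  qed
  have above: "turn p q r < 0" if "p \<in> Hplus" "q \<in> Hplus" "r \<in> Hminus" "fst p < fst q" for p q r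
  proof (rule turn_neg_if_below[OF _ that(4)])
    have "p \<noteq> q" using that(4) by auto
    then show "strictly_below_line r (affine hull {p, q})"
      using split.hyps(9) that(1-3) by (simp add: lines_above_def)
  qed
  have below: "turn p q r > 0" if "p \<in> Hminus" "q \<in> Hminus" "r \<in> Hplus" "fst p < fst q" for p q r
  proof (rule turn_pos_if_above[OF _ that(4)])
    have "p \<noteq> q" using that(4) by auto
    then show "strictly_above_line r (affine hull {p, q})"
      using split.hyps(10) that(1-3) by (simp add: lines_below_def)
  qed
  \<comment> \<open>Ranks are indices minus one, so the parities are opposite to those in
    \<open>below_chord\<close>. The rank of \<open>c\<close> is positive, which rules out the
    default branch.\<close>
  have low: "below_chord (x_rank H a) (x_rank H b) (x_rank H c) =
     (if even i = even j \<and> even j = even k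
      then below_chord ((i - 1) div 2) ((j - 1) div 2) ((k - 1) div 2)
      else if even i = even k then even i else odd j)"
    using ijk \<open>i < j\<close> \<open>j < k\<close> unfolding abc
    by (subst below_chord.simps) (auto simp: x_rank)
  have "fst a < fst c" using split.prems(4,5) by simp
  consider "even i = even j" "even j = even k" | "even i = even k" "even i \<noteq> even j"
    | "even i = even j" "even i \<noteq> even k" | "even j = even k" "even i \<noteq> even j"
    by blast
  then show ?case
  proof cases
    case 1
    show ?thesis
    proof (cases "even i")
      case True
      then show ?thesis
        using split.IH(1)[of a b c] split.prems(4,5) 1 ijk low unfolding abc
        by (simp add: plus)
    next
      case False
      then show ?thesis
        using split.IH(2)[of a b c] split.prems(4,5) 1 ijk low unfolding abc
        by (simp add: minus)
    qed
  next
    \<comment> \<open>The point from the other half is the middle one, so the sign of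
      \<open>turn a c b\<close> is known and swapping back reverses it.\<close>
    case 2
    show ?thesis
    proof (cases "even i")
      case True
      then have "turn a c b < 0"
        using above[OF plus(1) plus(1) minus(1)] 2 ijk \<open>fst a < fst c\<close> unfolding abc by simp
      then show ?thesis using True 2 low turn_swap[of a c b] by simp
    next
      case False
      then have "turn a c b > 0"
        using below[OF minus(1) minus(1) plus(1)] 2 ijk \<open>fst a < fst c\<close> unfolding abc by simp
      then show ?thesis using False 2 low turn_swap[of a c b] by simp
    qed
  next
    case 3
    show ?thesis
    proof (cases "even i")
      case True
      then have "turn a b c < 0"
        using above[OF plus(1) plus(1) minus(1)] 3 ijk split.prems(4) unfolding abc by simp
      then show ?thesis using True 3 low by simp
    next
      case False
      then have "turn a b c > 0"
        using below[OF minus(1) minus(1) plus(1)] 3 ijk split.prems(4) unfolding abc by simp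
      then show ?thesis using False 3 low by simp
    qed
  next
    case 4
    show ?thesis
    proof (cases "even i")
      case False
      then have "turn b c a < 0"
        using above[OF plus(1) plus(1) minus(1)] 4 ijk split.prems(5) unfolding abc by simp
      then show ?thesis using False 4 low turn_rotate[of b c a] by simp
    next
      case True
      then have "turn b c a > 0"
        using below[OF minus(1) minus(1) plus(1)] 4 ijk split.prems(5) unfolding abc by simp
      then show ?thesis using True 4 low turn_rotate[of b c a] by simp
    qed
  qed
qed

section \<open>Interior points in terms of ranks\<close>

text \<open>The argument \<open>b\<close> caches \<open>below_chord i j k\<close>. Nested conditionals rather than connectives
  keep the evaluation by rewriting lazy, here and in the next two functions.\<close>

definition inside_ranks :: "bool \<Rightarrow> nat \<Rightarrow> nat \<Rightarrow> nat \<Rightarrow> nat \<Rightarrow> bool" where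
  "inside_ranks b i j k m \<longleftrightarrow>
     (if below_chord i m k = b then
       if m < j then below_chord i m j \<noteq> b
       else if m = j then False else below_chord j m k \<noteq> b
      else False)"

fun at_least :: "nat \<Rightarrow> ('a \<Rightarrow> bool) \<Rightarrow> 'a list \<Rightarrow> bool" where
  "at_least n P [] = (n = 0)"
| "at_least n P (x # xs) =
    (if n = 0 then True else if P x then at_least (n - 1) P xs else at_least n P xs)"

lemma at_least_iff: "at_least n P xs \<longleftrightarrow> n \<le> length (filter P xs)"
  by (induction n P xs rule: at_least.induct) auto

text \<open>Only its failure is interpreted geometrically: it leaves at most one interior
  point.\<close>

definition two_inside :: "nat \<Rightarrow> nat \<Rightarrow> nat \<Rightarrow> bool" where
  "two_inside i j k \<longleftrightarrow> at_least 2 (inside_ranks (below_chord i j k) i j k) [Suc i..<k]"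

lemma x_rank_less_iff:
  assumes "finite S" "p \<in> S" "q \<in> S"
  shows "x_rank S p < x_rank S q \<longleftrightarrow> fst p < fst q"
proof -
  have "x_rank S p < x_rank S q" if "fst p < fst q" "p \<in> S" for p q
    unfolding x_rank_def by (intro psubset_card_mono) (use that assms(1) in auto)
  moreover have "x_rank S p = x_rank S q" if "fst p = fst q"
    using that by (simp add: x_rank_def)
  ultimately show ?thesis using assms by (metis less_asym linorder_less_linear)
qed

lemma horton_set_finite: "horton_set H \<Longrightarrow> finite H"
  by (induction rule: horton_set.induct) auto

text \<open>An interior point lies on the inner side of all three edges. \<open>inside_ranks\<close>
  tests the edge \<open>a c\<close> and whichever of \<open>a b\<close>, \<open>b c\<close> lies
  over the x-range of \<open>p\<close>. A necessary condition suffices for an upper bound on the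
  number of interior points.\<close>

lemma horton_interior_point:
  assumes H: "horton_set H" "a \<in> H" "b \<in> H" "c \<in> H" "fst a < fst b" "fst b < fst c"
    and p: "p \<in> H" "p \<in> interior (convex hull {a, b, c})" "fst p \<noteq> fst b"
  shows "x_rank H p \<in> {x_rank H a<..<x_rank H c}"
    "inside_ranks (below_chord (x_rank H a) (x_rank H b) (x_rank H c))
       (x_rank H a) (x_rank H b) (x_rank H c) (x_rank H p)"
proof -
  have abc: "turn a b c \<noteq> 0" "turn a b c > 0 \<longleftrightarrow> below_chord (x_rank H a) (x_rank H b) (x_rank H c)"
    using horton_turn[OF H] by auto
  have fin: "finite H" by (rule horton_set_finite[OF H(1)])
  obtain ap: "fst a < fst p" and pc: "fst p < fst c"
    and s: "sgn (turn a b p) = sgn (turn a b c)" "sgn (turn b c p) = sgn (turn a b c)"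
    "sgn (turn a p c) = sgn (turn a b c)"
    using interior_triangleE[OF p(2) abc(1) H(5,6)] by metis
  show "x_rank H p \<in> {x_rank H a<..<x_rank H c}"
    using ap pc p(1) H(2,4) fin by (simp add: x_rank_less_iff)
  have apc: "turn a p c > 0 \<longleftrightarrow> below_chord (x_rank H a) (x_rank H p) (x_rank H c)"
    using horton_turn[OF H(1,2) p(1) H(4) ap pc] by simp
  have pos: "x > 0 \<longleftrightarrow> y > 0" if "sgn x = sgn y" for x y :: real
    using that by (metis sgn_1_pos sgn_greater)
  \<comment> \<open>Listing \<open>p\<close> in x-order between the ends of an edge
    \<open>a b\<close> or \<open>b c\<close> swaps two arguments of \<open>turn\<close> and reverses
    the sign. Hence the inequalities in \<open>inside_ranks\<close>.\<close>
  have neg: "- x > 0 \<longleftrightarrow> \<not> y > 0" if "sgn x = sgn y" "y \<noteq> 0" for x y :: real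
    using that by (auto simp: sgn_if split: if_splits)
  show "inside_ranks (below_chord (x_rank H a) (x_rank H b) (x_rank H c))
       (x_rank H a) (x_rank H b) (x_rank H c) (x_rank H p)"
  proof (cases "fst p < fst b")
    case True
    then have "turn a p b > 0 \<longleftrightarrow> below_chord (x_rank H a) (x_rank H p) (x_rank H b)"
      using horton_turn[OF H(1,2) p(1) H(3) ap] by simp
    moreover have "turn a p b = - turn a b p" by (rule turn_swap)
    ultimately show ?thesis
      using True abc apc pos[OF s(3)] neg[OF s(1) abc(1)] fin p(1) H(3)
      by (simp add: inside_ranks_def x_rank_less_iff)
  next
    case False
    then have bp: "fst b < fst p" using p(3) by simp
    then have "turn b p c > 0 \<longleftrightarrow> below_chord (x_rank H b) (x_rank H p) (x_rank H c)"
      using horton_turn[OF H(1,3) p(1) H(4) bp pc] by simp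
    moreover have "turn b p c = - turn b c p" by (rule turn_swap)
    moreover have "x_rank H b < x_rank H p" using bp fin p(1) H(3) by (simp add: x_rank_less_iff)
    ultimately show ?thesis
      using abc apc pos[OF s(3)] neg[OF s(2) abc(1)]
      by (simp add: inside_ranks_def)
  qed
qed

section \<open>Exhaustive search\<close>

text \<open>Backtracking search: \<open>S\<close> holds the elements chosen so far, and \<open>n\<close> more are to be chosen
  from the candidates \<open>C\<close>.\<close>

fun refuted :: "(nat \<Rightarrow> nat \<Rightarrow> nat \<Rightarrow> bool) \<Rightarrow> nat list \<Rightarrow> nat \<Rightarrow> nat list \<Rightarrow> bool" where
  "refuted R S n [] = (0 < n)"
| "refuted R S n (v # C) =
    (if n = 0 then False
     else if length C + 1 < n then True
     else if refuted R (v # S) (n - 1) (filter (\<lambda>c. list_all (\<lambda>s. R s v c) S) C)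
     then refuted R S n C
     else False)"

text \<open>A set \<open>A\<close> all of whose triples satisfy \<open>R\<close> survives the
  search. If the head \<open>v\<close> lies in \<open>A\<close>, the filter keeps all of
  \<open>A - {v}\<close> by compatibility with \<open>S\<close>; otherwise \<open>A\<close> lies
  within the tail. The length cut-off cannot fire, since the list contains \<open>A\<close>.\<close>

lemma not_refuted:
  assumes "sorted_wrt (<) C" "A \<subseteq> set C" "card A = n"
    and "\<And>s v c. s \<in> set S \<Longrightarrow> v \<in> A \<Longrightarrow> c \<in> A \<Longrightarrow> v < c \<Longrightarrow> R s v c"
    and "\<And>i j k. i \<in> A \<Longrightarrow> j \<in> A \<Longrightarrow> k \<in> A \<Longrightarrow> i < j \<Longrightarrow> j < k \<Longrightarrow> R i j k"
  shows "\<not> refuted R S n C"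
  using assms
proof (induction R S n C arbitrary: A rule: refuted.induct)
  case (1 R S n)
  then show ?case by simp
next
  case (2 R S n v C)
  have "card A \<le> length C + 1"
    using card_mono[OF _ 2(4)] card_length[of "v # C"] by simp
  then have len: "\<not> length C + 1 < n" using 2(5) by simp
  have "\<not> refuted R (v # S) (n - 1) (filter (\<lambda>c. list_all (\<lambda>s. R s v c) S) C)" if "v \<in> A" "n \<noteq> 0"
  proof (rule "2.IH"(1)[OF that(2) len, of "A - {v}"])
    show "sorted_wrt (<) (filter (\<lambda>c. list_all (\<lambda>s. R s v c) S) C)"
      using 2(3) by (simp add: sorted_wrt_filter)
    show "A - {v} \<subseteq> set (filter (\<lambda>c. list_all (\<lambda>s. R s v c) S) C)"
      using 2(3,4,6) that(1) by (auto simp: list_all_iff)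
    show "card (A - {v}) = n - 1" using that(1) 2(5) by simp
    show "R s w c" if "s \<in> set (v # S)" "w \<in> A - {v}" "c \<in> A - {v}" "w < c" for s w c
    proof (cases "s = v")
      case True
      \<comment> \<open>\<open>v\<close> heads a sorted list, so \<open>v\<close>, \<open>w\<close>,
        \<open>c\<close> is an increasing triple of \<open>A\<close>.\<close>
      have "v < w" using that(2) 2(3,4) by auto
      then show ?thesis using True that \<open>v \<in> A\<close> 2(7) by blast
    next
      case False
      then show ?thesis using that 2(6) by auto
    qed
    show "R i j k" if "i \<in> A - {v}" "j \<in> A - {v}" "k \<in> A - {v}" "i < j" "j < k" for i j k
      using that 2(7) by blast
  qed
  moreover have "\<not> refuted R S n C"
    if "v \<notin> A" "n \<noteq> 0" "refuted R (v # S) (n - 1) (filter (\<lambda>c. list_all (\<lambda>s. R s v c) S) C)"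
  proof (rule "2.IH"(2)[OF that(2) len that(3)])
    show "A \<subseteq> set C" using that(1) 2(4) by auto
  qed (use 2(3-7) in auto)
  ultimately show ?case
    unfolding refuted.simps using len by (simp only: if_bool_eq_conj) blast
qed

text \<open>The search runs by rewriting with code equations, so the kernel checks every
  step.\<close>

lemma refuted_two_inside: "refuted two_inside [] 7 [0..<26]"
  by code_simp

lemma seven_ranks_not_all_two_inside:
  assumes "A \<subseteq> {..<26}" "card A = 7"
  obtains i j k where "i \<in> A" "j \<in> A" "k \<in> A" "i < j" "j < k" "\<not> two_inside i j k"
proof (rule ccontr)
  assume "\<not> thesis"
  then have "\<And>i j k. i \<in> A \<Longrightarrow> j \<in> A \<Longrightarrow> k \<in> A \<Longrightarrow> i < j \<Longrightarrow> j < k \<Longrightarrow> two_inside i j k"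
    using that by blast
  moreover have "sorted_wrt (<) [0..<26]" "A \<subseteq> set [0..<26]"
    using assms(1) by (simp_all add: lessThan_atLeast0)
  ultimately have "\<not> refuted two_inside [] 7 [0..<26]"
    using assms(2) by (intro not_refuted[of _ A]) simp_all
  with refuted_two_inside show False by contradiction
qed

section \<open>Back to points: counting and colouring\<close>

lemma horton_set_inj_fst: "horton_set H \<Longrightarrow> inj_on fst H"
proof (induction rule: horton_set.induct)
  case (small H)
  then show ?case
    using card_le_Suc0_iff_eq[OF small.hyps(1)] by (simp add: inj_on_def)
next
  case (split n H h Hplus Hminus)
  show ?case
    unfolding split.hyps(2)
    by (rule inj_on_imageI)
      (use strict_mono_on_imp_inj_on[OF split.hyps(3)] in \<open>simp add: comp_def\<close>)
qed

lemma bij_betw_x_rank: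
  assumes "finite S" "inj_on fst S"
  shows "bij_betw (x_rank S) S {..<card S}"
proof -
  have "inj_on (x_rank S) S"
  proof (rule inj_onI)
    fix p q assume pq: "p \<in> S" "q \<in> S" "x_rank S p = x_rank S q"
    then have "fst p = fst q"
      using x_rank_less_iff[OF assms(1), of p q] x_rank_less_iff[OF assms(1), of q p] by auto
    with pq assms(2) show "p = q" by (auto dest: inj_onD)
  qed
  moreover have "x_rank S ` S \<subseteq> {..<card S}"
    unfolding x_rank_def using assms(1) by (auto intro!: psubset_card_mono)
  ultimately show ?thesis
    by (simp add: bij_betw_def card_image card_subset_eq)
qed

text \<open>Ranks map the interior points injectively into the list that \<open>two_inside\<close>
  counts.\<close>

lemma horton_card_interior:
  assumes H: "horton_set H" "a \<in> H" "b \<in> H" "c \<in> H" "fst a < fst b" "fst b < fst c"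
    and "\<not> two_inside (x_rank H a) (x_rank H b) (x_rank H c)"
  shows "card (H \<inter> interior (convex hull {a, b, c})) \<le> 1"
proof -
  let ?I = "H \<inter> interior (convex hull {a, b, c})"
  let ?F = "filter (inside_ranks (below_chord (x_rank H a) (x_rank H b) (x_rank H c))
     (x_rank H a) (x_rank H b) (x_rank H c)) [Suc (x_rank H a)..<x_rank H c]"
  have fin: "finite H" by (rule horton_set_finite[OF H(1)])
  have inj: "inj_on fst H" by (rule horton_set_inj_fst[OF H(1)])
  have "x_rank H ` ?I \<subseteq> set ?F"
  proof
    fix m assume "m \<in> x_rank H ` ?I"
    then obtain p where p: "p \<in> H" "p \<in> interior (convex hull {a, b, c})" "m = x_rank H p" by auto
    have "p \<noteq> b"
      using interior_triangleE[OF p(2) _ H(5,6)] horton_turn[OF H] by metis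
    then have "fst p \<noteq> fst b" using inj p(1) H(3) by (auto dest: inj_onD)
    from horton_interior_point[OF H p(1,2) this] show "m \<in> set ?F" by (auto simp: p(3))
  qed
  moreover have "inj_on (x_rank H) ?I"
    using bij_betw_x_rank[OF fin inj] by (auto simp: bij_betw_def inj_on_def)
  ultimately have "card ?I \<le> card (set ?F)"
    by (metis card_image card_mono List.finite_set)
  also have "\<dots> \<le> length ?F" by (rule card_length)
  finally show ?thesis using assms(7) by (simp add: two_inside_def at_least_iff)
qed

theorem theorem3:
  fixes H :: "(real \<times> real) set" and col :: "real \<times> real \<Rightarrow> nat"
  assumes "horton_set H"
    and "card H \<ge> 26"
    and "\<forall>p\<in>H. col p \<in> {1..4}"
  shows "\<exists>a\<in>H. \<exists>b\<in>H. \<exists>c\<in>H. a \<noteq> b \<and> a \<noteq> c \<and> b \<noteq> c \<and> col a = col b \<and> col b = col c \<and>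
           card (H \<inter> interior (convex hull {a, b, c})) \<le> 1"
proof -
  have fin: "finite H" by (rule horton_set_finite[OF assms(1)])
  have bij: "bij_betw (x_rank H) H {..<card H}"
    by (rule bij_betw_x_rank[OF fin horton_set_inj_fst[OF assms(1)]])
  \<comment> \<open>\<open>g i\<close> is the point of rank \<open>i\<close> in all of
    \<open>H\<close>; its values below 26 give the 26 leftmost points.\<close>
  define g where "g = inv_into H (x_rank H)"
  have g: "g i \<in> H" "x_rank H (g i) = i" if "i < 26" for i
    using that assms(2) bij unfolding g_def bij_betw_def
    by (auto intro: inv_into_into f_inv_into_f)
  define cls where "cls t = {i \<in> {..<26}. col (g i) = t}" for t
  \<comment> \<open>Four classes of at most six ranks would cover only 24 of the 26.\<close>
  have "\<exists>t. 7 \<le> card (cls t)"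
  proof (rule ccontr)
    assume "\<not> ?thesis"
    then have "card (cls t) < 7" for t by (simp add: not_le)
    then have "card (cls t) \<le> 6" for t using less_Suc_eq_le[of "card (cls t)" 6] by simp
    then have "(\<Sum>t\<in>{1..4}. card (cls t)) \<le> 24"
      using sum_bounded_above[of "{1..4}" "\<lambda>t. card (cls t)" 6] by simp
    moreover have "{..<26} = (\<Union>t\<in>{1..4}. cls t)"
      using assms(3) g(1) by (fastforce simp: cls_def)
    then have "26 \<le> (\<Sum>t\<in>{1..4}. card (cls t))"
      using card_UN_le[of "{1..4}" cls] by (metis card_lessThan finite_atLeastAtMost)
    ultimately show False by simp
  qed
  then obtain t A where A: "A \<subseteq> cls t" "card A = 7"
    by (meson obtain_subset_with_card_n)
  have "A \<subseteq> {..<26}" using A(1) by (auto simp: cls_def)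
  then obtain i j k where ijk: "i \<in> A" "j \<in> A" "k \<in> A" "i < j" "j < k" "\<not> two_inside i j k"
    using seven_ranks_not_all_two_inside A(2) by blast
  then have lt: "i < 26" "j < 26" "k < 26" and c: "col (g i) = t" "col (g j) = t" "col (g k) = t"
    using A(1) by (auto simp: cls_def)
  have "fst (g i) < fst (g j)" "fst (g j) < fst (g k)"
    using x_rank_less_iff[OF fin] g lt ijk(4,5) by metis+
  moreover from this have "g i \<noteq> g j" "g i \<noteq> g k" "g j \<noteq> g k" by auto
  moreover from calculation(1,2) have "card (H \<inter> interior (convex hull {g i, g j, g k})) \<le> 1"
    using horton_card_interior[OF assms(1)] g lt ijk(6) by metis
  ultimately show ?thesis
    using g(1) lt c by metis
qed

end
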